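(* Let $T\ge1$. Suppose that, for each $t$, $f_t:Q\to\mathbb{R}$ is $M_t$-relatively Lipschitz-continuous and $\mu_t$-strongly convex with respect to the convex function $h$, and that $g:Q\to\mathbb{R}$ is $M_g$-relatively Lipschitz-continuous and $\mu_g$-strongly convex with respect to $h$; let $M=\max\{M_g,\max_tM_t\}$. Suppose that the switching Mirror Descent algorithm described in the context makes exactly $T$ productive steps (and then stops) and $\mathrm{Regret}_T\ge 0$. Suppose further that $\mu_t\ge\mu>0$ for all $1\le t\le T+T_J$, where $T_J$ is the number of non-productive steps. If the algorithm is run with $$\varepsilon=\frac{M^2}{\mu}\,\frac{1+\ln T}{T},$$ then the bound on the regret of the algorithm is $O(\ln T)$, i.e. $\mathrm{Regret}_T=O(\ln T)$ as $T\to\infty$ with $M$ and $\mu$ fixed.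
   Context: $Q\subset\mathbb{R}^n$ is a closed convex set, and $h$ is a convex, continuously differentiable function on $Q$ (prox-function). Its Bregman divergence is $V(y,x)=h(y)-h(x)-\langle\nabla h(x),y-x\rangle$. For a convex function $f$, $\nabla f(x)$ denotes its (sub)gradient at $x$ (the one used by the algorithm). A convex function $f:Q\to\mathbb{R}$ is $M$-relatively Lipschitz-continuous (with respect to $h$), $M>0$, if $\langle\nabla f(x),y-x\rangle+M\sqrt{2V(y,x)}\ge 0$ for all $x,y\in Q$. A function $f$ is $\mu$-strongly convex with respect to $h$ if $f(x)\ge f(y)+\langle\nabla f(y),x-y\rangle+\mu V(x,y)$ for all $x,y\in Q$. Algorithm. Given $\varepsilon>0$, $T$ and $x_1\in Q$, at iteration $t=1,2,\dots$: if $g(x_t)\le\varepsilon$ (step $t$ is "productive"), put $p_t=\nabla f_t(x_t)$; otherwise (step $t$ is "non-productive") put $p_t=\nabla g(x_t)$. Let $\eta_t=\frac{1}{\mu_{1:t}}$ and perform the Mirror Descent step $$x_{t+1}=\arg\min_{x\in Q}\{\eta_t\langle p_t,x\rangle+V(x,x_t)\}$$ (the minimizer is assumed to exist). Stop as soon as $T$ productive steps have been made. Here $\mu_{1:t}=\sum_{s=1}^t\mu_s$ and $\mu_{1:0}=0$, where $\mu_s$ is the strong convexity parameter of $f_s$ if step $s$ is productive and $\mu_s=\mu_g$ if step $s$ is non-productive. $I$ and $J$ denote the sets of indices of productive and non-productive steps, $|I|=T$ and $|J|=T_J$, so that $t$ runs over $1,\dots,T+T_J$. The loss $f_t$ is used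 only when $t\in I$. The regret is $$\mathrm{Regret}_T=\sum_{t\in I}f_t(x_t)-\min_{x\in Q,\ g(x)\le 0}\ \sum_{t\in I}f_t(x),$$ where the minimum is assumed to be attained at some $x^*\in Q$ with $g(x^* )\le 0$. *)

theory Defs
  imports "HOL-Analysis.Analysis" "HOL-Library.Landau_Symbols"
begin

text \<open>
  Gradients are carried as explicit functions next to the functions they belong to. For the
  prox-function, differentiability is relative to \<open>Q\<close>, which need not have interior points;
  the value of \<open>gradh x \<bullet> (y - x)\<close> for \<open>x\<close>, \<open>y\<close> in the convex set \<open>Q\<close> does not depend on
  the choice of \<open>gradh\<close>.
\<close>

definition prox_function ::
    "'a::euclidean_space set \<Rightarrow> ('a \<Rightarrow> real) \<Rightarrow> ('a \<Rightarrow> 'a) \<Rightarrow> bool" where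
  "prox_function Q h gradh \<longleftrightarrow>
     convex_on Q h \<and>
     (\<forall>x\<in>Q. (h has_derivative (\<lambda>v. gradh x \<bullet> v)) (at x within Q)) \<and>
     continuous_on Q gradh"

definition bregman ::
    "('a::euclidean_space \<Rightarrow> real) \<Rightarrow> ('a \<Rightarrow> 'a) \<Rightarrow> 'a \<Rightarrow> 'a \<Rightarrow> real" where
  "bregman h gradh y x = h y - h x - gradh x \<bullet> (y - x)"

text \<open>A choice of one subgradient of \<open>f\<close>, relative to \<open>Q\<close>, at every point of \<open>Q\<close>.\<close>

definition subgradient_on ::
    "'a::euclidean_space set \<Rightarrow> ('a \<Rightarrow> real) \<Rightarrow> ('a \<Rightarrow> 'a) \<Rightarrow> bool" where
  "subgradient_on Q f gradf \<longleftrightarrow> (\<forall>x\<in>Q. \<forall>y\<in>Q. f y \<ge> f x + gradf x \<bullet> (y - x))"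

definition rel_lipschitz_on ::
    "'a::euclidean_space set \<Rightarrow> ('a \<Rightarrow> real) \<Rightarrow> ('a \<Rightarrow> 'a) \<Rightarrow> real \<Rightarrow>
     ('a \<Rightarrow> real) \<Rightarrow> ('a \<Rightarrow> 'a) \<Rightarrow> bool" where
  "rel_lipschitz_on Q h gradh M f gradf \<longleftrightarrow>
     M > 0 \<and> convex_on Q f \<and> subgradient_on Q f gradf \<and>
     (\<forall>x\<in>Q. \<forall>y\<in>Q. gradf x \<bullet> (y - x) + M * sqrt (2 * bregman h gradh y x) \<ge> 0)"

definition rel_strongly_convex_on ::
    "'a::euclidean_space set \<Rightarrow> ('a \<Rightarrow> real) \<Rightarrow> ('a \<Rightarrow> 'a) \<Rightarrow> real \<Rightarrow>
     ('a \<Rightarrow> real) \<Rightarrow> ('a \<Rightarrow> 'a) \<Rightarrow> bool" where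
  "rel_strongly_convex_on Q h gradh \<mu> f gradf \<longleftrightarrow>
     (\<forall>x\<in>Q. \<forall>y\<in>Q. f x \<ge> f y + gradf y \<bullet> (x - y) + \<mu> * bregman h gradh x y)"

definition productive ::
    "('a \<Rightarrow> real) \<Rightarrow> real \<Rightarrow> (nat \<Rightarrow> 'a) \<Rightarrow> nat \<Rightarrow> nat set" where
  "productive g \<epsilon> x n = {t \<in> {1..n}. g (x t) \<le> \<epsilon>}"

definition step_param ::
    "('a \<Rightarrow> real) \<Rightarrow> real \<Rightarrow> (nat \<Rightarrow> 'a) \<Rightarrow> (nat \<Rightarrow> real) \<Rightarrow> real \<Rightarrow> nat \<Rightarrow> real" where
  "step_param g \<epsilon> x mf mg t = (if g (x t) \<le> \<epsilon> then mf t else mg)"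

text \<open>
  \<open>x\<close> is a sequence of iterates produced by a run that stops after exactly \<open>N\<close> steps, namely as
  soon as \<open>T\<close> productive steps have been made. If a step has several minimizers, any of them may
  be the next iterate. Only \<open>x 1, \<dots>, x (N + 1)\<close> are meaningful.
\<close>

definition switching_mirror_descent ::
    "'a::euclidean_space set \<Rightarrow> ('a \<Rightarrow> real) \<Rightarrow> ('a \<Rightarrow> 'a) \<Rightarrow>
     (nat \<Rightarrow> 'a \<Rightarrow> 'a) \<Rightarrow> (nat \<Rightarrow> real) \<Rightarrow> ('a \<Rightarrow> real) \<Rightarrow> ('a \<Rightarrow> 'a) \<Rightarrow> real \<Rightarrow>
     real \<Rightarrow> nat \<Rightarrow> nat \<Rightarrow> (nat \<Rightarrow> 'a) \<Rightarrow> bool" where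
  "switching_mirror_descent Q h gradh gradf mf g gradg mg \<epsilon> T N x \<longleftrightarrow>
     x 1 \<in> Q \<and>
     (\<forall>t\<in>{1..N}.
        let p = (if g (x t) \<le> \<epsilon> then gradf t (x t) else gradg (x t));
            \<eta> = 1 / (\<Sum>s=1..t. step_param g \<epsilon> x mf mg s)
        in is_arg_min (\<lambda>y. \<eta> * (p \<bullet> y) + bregman h gradh y (x t)) (\<lambda>y. y \<in> Q) (x (Suc t))) \<and>
     card (productive g \<epsilon> x N) = T \<and>
     (\<forall>n<N. card (productive g \<epsilon> x n) < T)"

text \<open>
  The infimum is the minimum whenever the latter is attained; attainment is to be assumed
  wherever \<open>regret\<close> is used.
\<close>

definition regret ::
    "'a set \<Rightarrow> (nat \<Rightarrow> 'a \<Rightarrow> real) \<Rightarrow> ('a \<Rightarrow> real) \<Rightarrow> nat set \<Rightarrow> (nat \<Rightarrow> 'a) \<Rightarrow> real" where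
  "regret Q f g I x =
     (\<Sum>t\<in>I. f t (x t)) - (INF y\<in>{y \<in> Q. g y \<le> 0}. \<Sum>t\<in>I. f t y)"

end

theory Submission
  imports Defs
begin

text \<open>
  Write \<open>V\<^sub>t\<close> for the Bregman divergence from \<open>x\<^sub>t\<close> to the comparator \<open>x\<^sup>*\<close>. Strong convexity
  supplies the term \<open>- \<mu>\<^sub>t V\<^sub>t\<close>, which with \<open>\<eta>\<^sub>t = 1 / \<mu>\<^bsub>1:t\<^esub>\<close> makes the Mirror Descent
  inequality telescope and leaves
  \<open>\<Sum>\<^sub>t M\<^sup>2 / (2 \<mu>\<^bsub>1:t\<^esub>) \<le> M\<^sup>2 / (2 \<mu>) (1 + ln (T + T\<^sub>J))\<close>. Each non-productive step gains
  more than \<open>\<epsilon>\<close>, and as \<open>ln (T + T\<^sub>J) \<le> ln T + T\<^sub>J / T\<close>, the gain \<open>\<epsilon> T\<^sub>J\<close> absorbs the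
  dependence on \<open>T\<^sub>J\<close>.
\<close>

section \<open>One-sided derivatives along segments of a convex set\<close>

text \<open>Differentiability is only relative to \<open>Q\<close>, which may have empty interior.
  By convexity the segment from \<open>z\<close> to \<open>u\<close> stays in \<open>Q\<close>, so
  restricting \<open>F\<close> to it leaves a one-sided derivative of a function of one real
  variable.\<close>

lemma has_real_derivative_along_segment:
  fixes F :: "'a::real_normed_vector \<Rightarrow> real"
  assumes "convex Q" "z \<in> Q" "u \<in> Q" "(F has_derivative D) (at z within Q)"
  shows "((\<lambda>t. F (z + t *\<^sub>R (u - z))) has_real_derivative D (u - z)) (at 0 within {0..1})"
proof -
  let ?l = "\<lambda>t::real. z + t *\<^sub>R (u - z)"
  have "?l ` {0..1} \<subseteq> Q"
  proof (clarsimp)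
    fix t :: real assume "0 \<le> t" "t \<le> 1"
    then have "(1 - t) *\<^sub>R z + t *\<^sub>R u \<in> Q"
      using assms by (intro convexD) auto
    then show "z + t *\<^sub>R (u - z) \<in> Q" by (simp add: algebra_simps)
  qed
  then have F: "(F has_derivative D) (at (?l 0) within ?l ` {0..1})"
    using assms(4) by (auto intro: has_derivative_subset)
  have "(?l has_derivative (\<lambda>t. t *\<^sub>R (u - z))) (at 0 within {0..1})"
    by (auto intro!: derivative_eq_intros)
  from has_derivative_in_compose[OF this F]
  have "((\<lambda>t. F (?l t)) has_derivative (\<lambda>t. D (t *\<^sub>R (u - z)))) (at 0 within {0..1})" .
  moreover have "D (t *\<^sub>R (u - z)) = D (u - z) * t" for t
    using linear_cmul[OF has_derivative_linear[OF assms(4)]] by simp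
  ultimately show ?thesis by (simp add: has_field_derivative_def)
qed

text \<open>First-order optimality: a negative slope towards \<open>u\<close> would make
  \<open>F\<close> drop strictly just after leaving \<open>z\<close>, at points that still lie in
  \<open>Q\<close>.\<close>

lemma has_derivative_nonneg_at_min:
  fixes F :: "'a::real_normed_vector \<Rightarrow> real"
  assumes "convex Q" "z \<in> Q" "u \<in> Q" "(F has_derivative D) (at z within Q)"
    and min: "\<And>y. y \<in> Q \<Longrightarrow> F z \<le> F y"
  shows "D (u - z) \<ge> 0"
proof (rule ccontr)
  assume "\<not> ?thesis"
  then obtain d where d: "d > 0"
    "\<And>t. 0 < t \<Longrightarrow> 0 + t \<in> {0..1} \<Longrightarrow> t < d \<Longrightarrow>
       F (z + (0 + t) *\<^sub>R (u - z)) < F (z + 0 *\<^sub>R (u - z))"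
    using has_real_derivative_neg_dec_right[OF has_real_derivative_along_segment[OF assms(1-4)]]
    by force
  obtain t where t: "0 < t" "t < d" "t \<le> 1"
    using \<open>d > 0\<close> by (intro that[of "min (d / 2) 1"]) (auto simp: min_def)
  have "(1 - t) *\<^sub>R z + t *\<^sub>R u \<in> Q"
    using assms t by (intro convexD) auto
  then have "z + t *\<^sub>R (u - z) \<in> Q" by (simp add: algebra_simps)
  then show False using d(2)[of t] min[of "z + t *\<^sub>R (u - z)"] t by auto
qed

lemma convex_on_has_derivative_le:
  fixes h :: "'a::real_normed_vector \<Rightarrow> real"
  assumes "convex_on Q h" "x \<in> Q" "u \<in> Q" "(h has_derivative D) (at x within Q)"
  shows "D (u - x) \<le> h u - h x"
proof (rule ccontr)
  \<comment> \<open>Subtracting the slope of the chord turns convexity into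
    \<open>?\<psi> t \<le> ?\<psi> 0\<close>, which a positive derivative at 0 contradicts.\<close>
  let ?\<psi> = "\<lambda>t. h (x + t *\<^sub>R (u - x)) - t * (h u - h x)"
  assume "\<not> ?thesis"
  then have pos: "0 < D (u - x) - (h u - h x)" by simp
  have "((\<lambda>t. t * (h u - h x)) has_real_derivative h u - h x) (at 0 within {0..1})"
    by (auto intro!: derivative_eq_intros)
  from DERIV_diff[OF has_real_derivative_along_segment[OF convex_on_imp_convex[OF assms(1)] assms(2-4)] this]
  have "(?\<psi> has_real_derivative D (u - x) - (h u - h x)) (at 0 within {0..1})" .
  from has_real_derivative_pos_inc_right[OF this pos]
  obtain d where d: "d > 0" "\<And>t. 0 < t \<Longrightarrow> 0 + t \<in> {0..1} \<Longrightarrow> t < d \<Longrightarrow> ?\<psi> 0 < ?\<psi> (0 + t)"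
    by blast
  obtain t where t: "0 < t" "t < d" "t \<le> 1"
    using \<open>d > 0\<close> by (intro that[of "min (d / 2) 1"]) (auto simp: min_def)
  have "h ((1 - t) *\<^sub>R x + t *\<^sub>R u) \<le> (1 - t) * h x + t * h u"
    using assms(1-3) t by (intro convex_onD) auto
  also have "(1 - t) *\<^sub>R x + t *\<^sub>R u = x + t *\<^sub>R (u - x)" by (simp add: algebra_simps)
  finally have "?\<psi> t \<le> ?\<psi> 0" by (simp add: algebra_simps)
  with d(2)[of t] t show False by simp
qed

section \<open>Bregman divergence and a single Mirror Descent step\<close>

lemma bregman_nonneg:
  assumes "prox_function Q h gradh" "x \<in> Q" "y \<in> Q"
  shows "bregman h gradh y x \<ge> 0"
  using convex_on_has_derivative_le[of Q h x y "\<lambda>v. gradh x \<bullet> v"] assms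
  by (simp add: prox_function_def bregman_def)

text \<open>Optimality of \<open>z\<close> is tested in the direction \<open>u - z\<close>. The
  divergence from \<open>x\<close> has gradient \<open>gradh z - gradh x\<close> at
  \<open>z\<close>, and the inner product of this with \<open>u - z\<close> is exactly the
  right-hand side (three-point identity).\<close>

lemma mirror_step_three_point:
  assumes "convex Q" "prox_function Q h gradh" "u \<in> Q"
    and min: "is_arg_min (\<lambda>y. \<eta> * (p \<bullet> y) + bregman h gradh y x) (\<lambda>y. y \<in> Q) z"
  shows "\<eta> * (p \<bullet> (z - u)) \<le> bregman h gradh u x - bregman h gradh u z - bregman h gradh z x"
proof -
  have z: "z \<in> Q" using min by (simp add: is_arg_min_def)
  have h: "(h has_derivative (\<lambda>v. gradh z \<bullet> v)) (at z within Q)"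
    using assms(2) z by (simp add: prox_function_def)
  have "((\<lambda>y. \<eta> * (p \<bullet> y) + bregman h gradh y x) has_derivative
          (\<lambda>v. \<eta> * (p \<bullet> v) + (gradh z \<bullet> v - gradh x \<bullet> v))) (at z within Q)"
    unfolding bregman_def by (auto intro!: derivative_eq_intros h)
  then have "\<eta> * (p \<bullet> (u - z)) + (gradh z \<bullet> (u - z) - gradh x \<bullet> (u - z)) \<ge> 0"
    by (rule has_derivative_nonneg_at_min[OF assms(1) z assms(3)])
       (use min in \<open>auto simp: is_arg_min_def not_less\<close>)
  then show ?thesis by (simp add: bregman_def inner_diff_right algebra_simps)
qed

text \<open>Passing from \<open>z\<close> back to \<open>x\<close> costs \<eta> times
  \<open>p \<bullet> (x - z)\<close>. Relative Lipschitz continuity and Young's inequality bound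
  this by the divergence of \<open>z\<close> from \<open>x\<close>, which the three-point inequality
  cancels, plus the last term of the claim.\<close>

lemma mirror_step_progress:
  assumes "convex Q" "prox_function Q h gradh" "x \<in> Q" "u \<in> Q" "\<eta> \<ge> 0"
    and min: "is_arg_min (\<lambda>y. \<eta> * (p \<bullet> y) + bregman h gradh y x) (\<lambda>y. y \<in> Q) z"
    and lip: "\<And>y. y \<in> Q \<Longrightarrow> p \<bullet> (y - x) + M * sqrt (2 * bregman h gradh y x) \<ge> 0"
  shows "\<eta> * (p \<bullet> (x - u)) \<le> bregman h gradh u x - bregman h gradh u z + \<eta>\<^sup>2 * M\<^sup>2 / 2"
proof -
  define s where "s = sqrt (2 * bregman h gradh z x)"
  have z: "z \<in> Q" using min by (simp add: is_arg_min_def)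
  have s: "bregman h gradh z x = s\<^sup>2 / 2"
    using bregman_nonneg[OF assms(2,3) z] by (simp add: s_def)
  have "p \<bullet> (x - z) \<le> M * s"
    using lip[OF z] by (simp add: s_def inner_diff_right)
  then have "\<eta> * (p \<bullet> (x - z)) \<le> \<eta> * (M * s)"
    using \<open>\<eta> \<ge> 0\<close> by (rule mult_left_mono)
  also have "\<dots> \<le> s\<^sup>2 / 2 + \<eta>\<^sup>2 * M\<^sup>2 / 2"
    using zero_le_power2[of "s - \<eta> * M"] by (simp add: power2_eq_square algebra_simps)
  finally show ?thesis
    using mirror_step_three_point[OF assms(1,2,4) min] s
    by (simp add: inner_diff_right algebra_simps)
qed

section \<open>Summation over all steps\<close>

text \<open>The two kinds of steps are treated alike: \<open>d t\<close> is any quantity controlled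
  by the linearised gap at \<open>x t\<close> minus the strong convexity term. The harmonic number
  comes from the partial sums of \<open>m\<close> growing at least like
  \<open>t * \<mu>\<close>.\<close>

lemma mirror_descent_regret_le:
  fixes x :: "nat \<Rightarrow> 'a::euclidean_space"
  assumes Q: "convex Q" "prox_function Q h gradh" "x 1 \<in> Q" "u \<in> Q" and "\<mu> > 0"
    and step: "\<And>t. t \<in> {1..N} \<Longrightarrow>
      is_arg_min (\<lambda>y. 1 / (\<Sum>s=1..t. m s) * (p t \<bullet> y) + bregman h gradh y (x t))
        (\<lambda>y. y \<in> Q) (x (Suc t))"
    and lip: "\<And>t y. \<lbrakk>t \<in> {1..N}; x t \<in> Q; y \<in> Q\<rbrakk> \<Longrightarrow>
      p t \<bullet> (y - x t) + M * sqrt (2 * bregman h gradh y (x t)) \<ge> 0"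
    and sc: "\<And>t. \<lbrakk>t \<in> {1..N}; x t \<in> Q\<rbrakk> \<Longrightarrow>
      d t \<le> p t \<bullet> (x t - u) - m t * bregman h gradh u (x t)"
    and m: "\<And>t. t \<in> {1..N} \<Longrightarrow> m t \<ge> \<mu>"
  shows "(\<Sum>t=1..N. d t) \<le> M\<^sup>2 / (2 * \<mu>) * harm N"
proof -
  let ?V = "\<lambda>t. bregman h gradh u (x t)" and ?S = "\<lambda>t. \<Sum>s=1..t. m s"
  \<comment> \<open>The range includes \<open>Suc N\<close>, since the telescoped sum ends with the
    divergence at \<open>x (Suc N)\<close>.\<close>
  have xQ: "x t \<in> Q" if "t \<in> {1..Suc N}" for t
  proof (cases "t = 1")
    case False
    then have "is_arg_min (\<lambda>y. 1 / ?S (t - 1) * (p (t - 1) \<bullet> y) + bregman h gradh y (x (t - 1)))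
        (\<lambda>y. y \<in> Q) (x (Suc (t - 1)))"
      using that by (intro step) auto
    then show ?thesis using that by (simp add: is_arg_min_def)
  qed (use Q in simp)
  have S: "?S t \<ge> real t * \<mu>" if "t \<le> N" for t
    using sum_mono[of "{1..t}" "\<lambda>_. \<mu>" m] m that by simp
  \<comment> \<open>The invariant keeps the weighted divergence at the next iterate, since the
    following step uses it up; for \<open>n = 0\<close> its weight is an empty sum.\<close>
  have "(\<Sum>t=1..n. d t) + ?S n * ?V (Suc n) \<le> M\<^sup>2 / (2 * \<mu>) * harm n" if "n \<le> N" for n
    using that
  proof (induction n)
    case 0
    then show ?case by (simp add: harm_def)
  next
    case (Suc n)
    let ?s = "?S (Suc n)" and ?p = "p (Suc n) \<bullet> (x (Suc n) - u)"
    have n: "Suc n \<in> {1..N}" "x (Suc n) \<in> Q" using Suc.prems xQ by auto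
    have s: "?s \<ge> real (Suc n) * \<mu>" "real (Suc n) * \<mu> > 0"
      using S[OF Suc.prems] \<open>\<mu> > 0\<close> by auto
    then have "?s > 0" by linarith
    have "1 / ?s * ?p \<le> ?V (Suc n) - ?V (Suc (Suc n)) + (1 / ?s)\<^sup>2 * M\<^sup>2 / 2"
      by (rule mirror_step_progress[OF Q(1,2) n(2) Q(4) _ step[OF n(1)] lip[OF n]])
         (use \<open>?s > 0\<close> in auto)
    then have "?p \<le> ?s * (?V (Suc n) - ?V (Suc (Suc n)) + (1 / ?s)\<^sup>2 * M\<^sup>2 / 2)"
      using \<open>?s > 0\<close> by (simp only: pos_divide_le_eq times_divide_eq_left mult_1 mult.commute)
    also have "\<dots> = ?s * (?V (Suc n) - ?V (Suc (Suc n))) + M\<^sup>2 / 2 / ?s"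
      using \<open>?s > 0\<close> by (simp add: field_simps power2_eq_square del: sum.cl_ivl_Suc)
    also have "M\<^sup>2 / 2 / ?s \<le> M\<^sup>2 / 2 / (real (Suc n) * \<mu>)"
      using s \<open>?s > 0\<close> by (intro divide_left_mono) auto
    also have "\<dots> = M\<^sup>2 / (2 * \<mu>) * inverse (real (Suc n))"
      by (simp add: divide_simps)
    finally have "?p \<le> ?s * (?V (Suc n) - ?V (Suc (Suc n))) +
      M\<^sup>2 / (2 * \<mu>) * inverse (real (Suc n))"
      by simp
    moreover note sc[OF n]
    \<comment> \<open>This is where the step size pays off: the summand with
      \<open>m (Suc n)\<close> is the one that \<open>sc\<close> subtracts, so only the weighted
      divergences of the invariant remain.\<close>
    moreover have "?s * (?V (Suc n) - ?V (Suc (Suc n))) =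
        ?S n * ?V (Suc n) + m (Suc n) * ?V (Suc n) - ?s * ?V (Suc (Suc n))"
      by (simp add: algebra_simps)
    moreover have "M\<^sup>2 / (2 * \<mu>) * harm (Suc n) =
        M\<^sup>2 / (2 * \<mu>) * harm n + M\<^sup>2 / (2 * \<mu>) * inverse (real (Suc n))"
      by (simp only: harm_Suc distrib_left)
    moreover have "(\<Sum>t=1..Suc n. d t) = (\<Sum>t=1..n. d t) + d (Suc n)" by simp
    moreover have "(\<Sum>t=1..n. d t) + ?S n * ?V (Suc n) \<le> M\<^sup>2 / (2 * \<mu>) * harm n"
      using Suc by simp
    ultimately show ?case by linarith
  qed
  from this[of N] have "(\<Sum>t=1..N. d t) + ?S N * ?V (Suc N) \<le> M\<^sup>2 / (2 * \<mu>) * harm N" by simp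
  moreover have "?V (Suc N) \<ge> 0"
    by (rule bregman_nonneg[OF Q(2) xQ Q(4)]) simp
  moreover have "real N * \<mu> \<ge> 0" using \<open>\<mu> > 0\<close> by simp
  then have "?S N \<ge> 0" using S[of N] by linarith
  ultimately show ?thesis using mult_nonneg_nonneg[of "?S N" "?V (Suc N)"] by linarith
qed

section \<open>Regret of the switching algorithm\<close>

lemma regret_eq_at_minimizer:
  assumes "is_arg_min (\<lambda>y. \<Sum>t\<in>I. f t y) (\<lambda>y. y \<in> Q \<and> g y \<le> 0) u"
  shows "regret Q f g I x = (\<Sum>t\<in>I. f t (x t) - f t u)"
proof -
  have "(INF y\<in>{y \<in> Q. g y \<le> 0}. \<Sum>t\<in>I. f t y) = (\<Sum>t\<in>I. f t u)"
    using assms by (intro cInf_eq_minimum) (auto simp: is_arg_min_def not_less)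
  then show ?thesis by (simp add: regret_def sum_subtractf)
qed

text \<open>The sequence \<open>harm k - ln k\<close> decreases from the value 1 at
  \<open>k = 1\<close>. The remaining logarithm is made linear in \<open>n\<close>, so that it can
  be compared with a gain proportional to the number of non-productive steps.\<close>

lemma harm_le_ln_plus_ratio:
  assumes "T \<ge> 1"
  shows "harm (T + n) \<le> 1 + ln (real T) + real n / real T"
proof -
  have "harm (T + n) - ln (real (T + n)) \<le> 1"
    using euler_mascheroni_sequence_decreasing[of 1 "T + n"] assms by (simp add: harm_def)
  moreover have "ln (real (T + n)) = ln (real T) + ln (1 + real n / real T)"
    using assms by (subst ln_mult_pos[symmetric]) (auto simp: field_simps add_pos_nonneg)
  moreover have "ln (1 + real n / real T) \<le> real n / real T"
    by (rule ln_add_one_self_le_self) simp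
  ultimately show ?thesis by linarith
qed

text \<open>The bound is free of \<open>TJ\<close>, which lets the theorem take a \<open>B\<close>
  that depends on \<open>T\<close> only.\<close>

lemma switching_mirror_descent_regret_le:
  fixes Q :: "'a::euclidean_space set"
  assumes "T \<ge> 1" "\<mu> > 0" and Q: "convex Q" "prox_function Q h gradh"
    and f: "\<And>t. t \<in> {1..T + TJ} \<Longrightarrow> rel_lipschitz_on Q h gradh (Mf t) (f t) (gradf t)"
           "\<And>t. t \<in> {1..T + TJ} \<Longrightarrow> rel_strongly_convex_on Q h gradh (mf t) (f t) (gradf t)"
    and g: "rel_lipschitz_on Q h gradh Mg g gradg" "rel_strongly_convex_on Q h gradh mg g gradg"
    and M: "Mg \<le> M" "\<And>t. t \<in> {1..T + TJ} \<Longrightarrow> Mf t \<le> M"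
    and \<epsilon>: "\<epsilon> = M\<^sup>2 / \<mu> * ((1 + ln (real T)) / real T)"
    and run: "switching_mirror_descent Q h gradh gradf mf g gradg mg \<epsilon> T (T + TJ) x"
    and \<mu>: "\<And>t. t \<in> {1..T + TJ} \<Longrightarrow> step_param g \<epsilon> x mf mg t \<ge> \<mu>"
    and u: "is_arg_min (\<lambda>y. \<Sum>t\<in>productive g \<epsilon> x (T + TJ). f t y) (\<lambda>y. y \<in> Q \<and> g y \<le> 0) u"
  shows "regret Q f g (productive g \<epsilon> x (T + TJ)) x \<le> M\<^sup>2 / (2 * \<mu>) * (1 + ln (real T))"
proof -
  let ?N = "T + TJ" and ?I = "productive g \<epsilon> x (T + TJ)"
  let ?p = "\<lambda>t. if g (x t) \<le> \<epsilon> then gradf t (x t) else gradg (x t)"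
  \<comment> \<open>At a non-productive step \<open>g (x t) - g u\<close> exceeds \<epsilon>,
    because \<open>g u \<le> 0\<close>; hence \<epsilon> is an admissible lower bound for the gap
    there.\<close>
  let ?d = "\<lambda>t. if g (x t) \<le> \<epsilon> then f t (x t) - f t u else \<epsilon>"
  have uQ: "u \<in> Q" "g u \<le> 0" using u by (auto simp: is_arg_min_def)
  have lip: "w \<bullet> v + M * sqrt (2 * b) \<ge> 0" if "w \<bullet> v + M' * sqrt (2 * b) \<ge> 0" "M' \<le> M" "b \<ge> 0"
    for w v :: 'a and b M'
    using that mult_right_mono[of M' M "sqrt (2 * b)"] by simp
  have "(\<Sum>t=1..?N. ?d t) \<le> M\<^sup>2 / (2 * \<mu>) * harm ?N"
  proof (rule mirror_descent_regret_le[OF Q _ uQ(1) \<open>\<mu> > 0\<close>, where p = ?p])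
    show "x 1 \<in> Q" using run by (simp add: switching_mirror_descent_def)
  next
    fix t assume "t \<in> {1..?N}"
    then show "is_arg_min (\<lambda>y. 1 / (\<Sum>s=1..t. step_param g \<epsilon> x mf mg s) * (?p t \<bullet> y) +
        bregman h gradh y (x t)) (\<lambda>y. y \<in> Q) (x (Suc t))"
      using run by (simp add: switching_mirror_descent_def Let_def)
  next
    fix t y assume t: "t \<in> {1..?N}" and x: "x t \<in> Q" and y: "y \<in> Q"
    show "?p t \<bullet> (y - x t) + M * sqrt (2 * bregman h gradh y (x t)) \<ge> 0"
      using f(1)[OF t] g(1) x y
        lip[OF _ M(1) bregman_nonneg[OF Q(2) x y]] lip[OF _ M(2)[OF t] bregman_nonneg[OF Q(2) x y]]
      by (simp add: rel_lipschitz_on_def)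
  next
    fix t assume t: "t \<in> {1..?N}" and x: "x t \<in> Q"
    have "f t u \<ge> f t (x t) + gradf t (x t) \<bullet> (u - x t) + mf t * bregman h gradh u (x t)"
      using f(2)[OF t] uQ x by (simp add: rel_strongly_convex_on_def)
    moreover have "g u \<ge> g (x t) + gradg (x t) \<bullet> (u - x t) + mg * bregman h gradh u (x t)"
      using g(2) uQ x by (simp add: rel_strongly_convex_on_def)
    ultimately show "?d t \<le> ?p t \<bullet> (x t - u) - step_param g \<epsilon> x mf mg t * bregman h gradh u (x t)"
      using uQ(2) by (auto simp: step_param_def inner_diff_right)
  qed (use \<mu> in auto)
  also have "\<dots> \<le> M\<^sup>2 / (2 * \<mu>) * (1 + ln (real T) + real TJ / real T)"
    using \<open>\<mu> > 0\<close> harm_le_ln_plus_ratio[OF \<open>T \<ge> 1\<close>] by (intro mult_left_mono) auto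
  finally have "(\<Sum>t=1..?N. ?d t) \<le> M\<^sup>2 / (2 * \<mu>) * (1 + ln (real T) + real TJ / real T)" .
  \<comment> \<open>Exactly \<open>T\<close> of the \<open>T + TJ\<close> steps are productive, so
    the other \<open>TJ\<close> contribute \<epsilon> each.\<close>
  moreover have "(\<Sum>t=1..?N. ?d t) = regret Q f g ?I x + real TJ * \<epsilon>"
  proof -
    have I: "?I = {1..?N} \<inter> {t. g (x t) \<le> \<epsilon>}" by (auto simp: productive_def)
    have "card ?I = T" using run by (simp add: switching_mirror_descent_def)
    moreover have "card ({1..?N} - ?I) = ?N - card ?I"
      by (subst card_Diff_subset) (auto simp: productive_def)
    moreover have "{1..?N} \<inter> - {t. g (x t) \<le> \<epsilon>} = {1..?N} - ?I" by (auto simp: productive_def)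
    ultimately show ?thesis
      unfolding regret_eq_at_minimizer[OF u] by (subst sum.If_cases) (auto simp: I)
  qed
  moreover have "M\<^sup>2 / (2 * \<mu>) * (real TJ / real T) \<le> real TJ * \<epsilon>"
  proof -
    \<comment> \<open>The two sides differ by the factor \<open>2 * (1 + ln T)\<close>, which is at
      least 1 since \<open>T \<ge> 1\<close>.\<close>
    have "M\<^sup>2 / (2 * \<mu>) * (real TJ / real T) * 1 \<le>
        M\<^sup>2 / (2 * \<mu>) * (real TJ / real T) * (2 * (1 + ln (real T)))"
      using \<open>\<mu> > 0\<close> \<open>T \<ge> 1\<close> by (intro mult_left_mono) auto
    also have "\<dots> = real TJ * \<epsilon>"
      using \<open>\<mu> > 0\<close> \<open>T \<ge> 1\<close> by (simp add: \<epsilon> field_simps)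
    finally show ?thesis by simp
  qed
  ultimately show ?thesis by (simp add: distrib_left)
qed

text \<open>Choosing \<open>B\<close> before the sets, functions and runs makes the estimate
  uniform: the constant hidden in the O-term depends on \<open>M\<close> and \<mu> but not on the
  problem instance.\<close>

theorem corollary1:
  fixes M \<mu> :: real
  assumes "\<mu> > 0"
  shows "\<exists>B :: nat \<Rightarrow> real. B \<in> O(\<lambda>T. ln (real T)) \<and>
    (\<forall>(Q :: (real ^ 'n) set) h gradh f gradf Mf mf g gradg Mg mg x T TJ \<epsilon>.
       T \<ge> 1 \<longrightarrow>
       closed Q \<longrightarrow> convex Q \<longrightarrow> prox_function Q h gradh \<longrightarrow>
       (\<forall>t\<in>{1..T + TJ}. rel_lipschitz_on Q h gradh (Mf t) (f t) (gradf t) \<and>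
                        rel_strongly_convex_on Q h gradh (mf t) (f t) (gradf t)) \<longrightarrow>
       rel_lipschitz_on Q h gradh Mg g gradg \<longrightarrow>
       rel_strongly_convex_on Q h gradh mg g gradg \<longrightarrow>
       M = max Mg (Max (Mf ` {1..T + TJ})) \<longrightarrow>
       \<epsilon> = M\<^sup>2 / \<mu> * ((1 + ln (real T)) / real T) \<longrightarrow>
       switching_mirror_descent Q h gradh gradf mf g gradg mg \<epsilon> T (T + TJ) x \<longrightarrow>
       (\<forall>t\<in>{1..T + TJ}. step_param g \<epsilon> x mf mg t \<ge> \<mu>) \<longrightarrow>
       (\<exists>xstar. is_arg_min (\<lambda>y. \<Sum>t\<in>productive g \<epsilon> x (T + TJ). f t y)
                  (\<lambda>y. y \<in> Q \<and> g y \<le> 0) xstar) \<longrightarrow>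
       regret Q f g (productive g \<epsilon> x (T + TJ)) x \<ge> 0 \<longrightarrow>
       regret Q f g (productive g \<epsilon> x (T + TJ)) x \<le> B T)"
proof (intro exI[of _ "\<lambda>T. M\<^sup>2 / (2 * \<mu>) * (1 + ln (real T))"] conjI allI impI)
  have "filterlim (\<lambda>T. ln (real T)) at_top sequentially"
    using filterlim_compose[OF ln_at_top filterlim_real_sequentially] .
  \<comment> \<open>Once \<open>ln T \<ge> 1\<close>, the summand 1 is absorbed by doubling the
    constant; at \<open>T = 1\<close> the logarithm vanishes, so the comparison can only hold
    eventually.\<close>
  then have "eventually (\<lambda>T. ln (real T) \<ge> 1) sequentially"
    by (simp add: filterlim_at_top)
  then have "eventually (\<lambda>T. norm (M\<^sup>2 / (2 * \<mu>) * (1 + ln (real T))) \<le>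
      M\<^sup>2 / (2 * \<mu>) * 2 * norm (ln (real T))) sequentially"
  proof eventually_elim
    case (elim T)
    then have "M\<^sup>2 / (2 * \<mu>) * (1 + ln (real T)) \<le> M\<^sup>2 / (2 * \<mu>) * (2 * ln (real T))"
      using assms by (intro mult_left_mono) auto
    then show ?case using elim assms by (simp add: abs_mult)
  qed
  then show "(\<lambda>T. M\<^sup>2 / (2 * \<mu>) * (1 + ln (real T))) \<in> O(\<lambda>T. ln (real T))" by (rule bigoI)
next
  fix Q :: "(real ^ 'n) set" and h gradh f gradf g gradg x
    and Mf mf :: "nat \<Rightarrow> real" and Mg mg \<epsilon> :: real and T TJ :: nat
  assume *: "T \<ge> 1" "convex Q" "prox_function Q h gradh"
      "\<forall>t\<in>{1..T + TJ}. rel_lipschitz_on Q h gradh (Mf t) (f t) (gradf t) \<and>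
         rel_strongly_convex_on Q h gradh (mf t) (f t) (gradf t)"
      "rel_lipschitz_on Q h gradh Mg g gradg" "rel_strongly_convex_on Q h gradh mg g gradg"
    and M: "M = max Mg (Max (Mf ` {1..T + TJ}))"
    and run: "\<epsilon> = M\<^sup>2 / \<mu> * ((1 + ln (real T)) / real T)"
      "switching_mirror_descent Q h gradh gradf mf g gradg mg \<epsilon> T (T + TJ) x"
      "\<forall>t\<in>{1..T + TJ}. step_param g \<epsilon> x mf mg t \<ge> \<mu>"
    and "\<exists>xstar. is_arg_min (\<lambda>y. \<Sum>t\<in>productive g \<epsilon> x (T + TJ). f t y)
      (\<lambda>y. y \<in> Q \<and> g y \<le> 0) xstar"
  then obtain u where "is_arg_min (\<lambda>y. \<Sum>t\<in>productive g \<epsilon> x (T + TJ). f t y)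
      (\<lambda>y. y \<in> Q \<and> g y \<le> 0) u" by blast
  moreover have "Mg \<le> M" "\<And>t. t \<in> {1..T + TJ} \<Longrightarrow> Mf t \<le> M"
    unfolding M by (auto intro!: max.coboundedI2 Max_ge)
  ultimately show "regret Q f g (productive g \<epsilon> x (T + TJ)) x \<le> M\<^sup>2 / (2 * \<mu>) * (1 + ln (real T))"
    using * run(3)
    by (intro switching_mirror_descent_regret_le[OF *(1) assms *(2,3) _ _ *(5,6) _ _ run(1,2)]) blast+
qed

end
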